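(* Let $d\ge 1$ and let $X$ and $X_{\mathbf n}$, $\mathbf n\in\mathbb Z_+^d$, be real-valued random variables on a probability space $(\Omega,\mathcal F,P)$ (no assumption is made on their dependence). Assume there is a constant $M>0$ such that $$\frac{1}{|\mathbf n|}\sum_{\mathbf k\preceq \mathbf n}P(|X_{\mathbf k}|>x)\le M\,P(|X|>x)\qquad\text{for all } x\ge 0 \text{ and all } \mathbf n\in\mathbb Z_+^d .$$ Assume $E\big[|X|\log^+|X|\big]<\infty$. For a positive integer $n$ write $N=(n,\dots,n)\in\mathbb Z_+^d$, so $|N|=n^d$. Then for almost all $t\in\mathbb T^d$ (with respect to Lebesgue measure), $$\lim_{n\to\infty}\frac{S_{N}(t)}{|N|}=0\qquad P\text{-almost surely}.$$
   Context: $\mathbb Z_+^d$ is the set of $d$-dimensional lattice points with positive integer coordinates. For $\mathbf k,\mathbf n\in\mathbb Z_+^d$, $\mathbf k\preceq\mathbf n$ means $k_i\le n_i$ for all $1\le i\le d$, and $|\mathbf n|=n_1n_2\cdots n_d$. $\mathbb T=[-\pi,\pi)$. For $t=(t_1,\dots,t_d)\in\mathbb T^d$, $\mathbf k\cdot t=k_1t_1+\cdots+k_dt_d$, and the discrete Fourier transform is $S_{\mathbf n}(t)=\sum_{\mathbf k\preceq\mathbf n}e^{i\mathbf k\cdot t}X_{\mathbf k}$. The notation $\log^+x$ means $\max\{1,\log x\}$ (equal to $1$ at $x=0$). *)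

theory Defs
  imports "HOL-Probability.Probability"
begin

text \<open>Points of the index lattice are vectors in \<open>nat ^ 'd\<close>, with \<open>d = CARD('d) \<ge> 1\<close>; the relation
  \<open>k \<le> n\<close> on this type is the componentwise order.\<close>

definition pos_lattice :: "(nat ^ 'd) set" where
  "pos_lattice = {n. \<forall>i. 1 \<le> n $ i}"

definition lattice_box :: "nat ^ 'd \<Rightarrow> (nat ^ 'd) set" where
  "lattice_box n = {k \<in> pos_lattice. k \<le> n}"

lemma finite_lattice_box: "finite (lattice_box (n :: nat ^ 'd))"
proof -
  have "vec_nth ` lattice_box n \<subseteq> (\<Pi>\<^sub>E i\<in>UNIV. {..n $ i})"
    by (auto simp: lattice_box_def less_eq_vec_def)
  then have "finite (vec_nth ` lattice_box n)"
    by (rule finite_subset) (simp add: finite_PiE)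
  then show ?thesis
    by (rule finite_imageD) (simp add: inj_on_def vec_nth_inject)
qed

definition lattice_vol :: "nat ^ 'd \<Rightarrow> nat" where
  "lattice_vol n = (\<Prod>i\<in>UNIV. n $ i)"

definition torus :: "(real ^ 'd) set" where
  "torus = {t. \<forall>i. - pi \<le> t $ i \<and> t $ i < pi}"

definition freq_dot :: "nat ^ 'd \<Rightarrow> real ^ 'd \<Rightarrow> real" where
  "freq_dot k t = (\<Sum>i\<in>UNIV. real (k $ i) * t $ i)"

definition dft :: "(nat ^ 'd \<Rightarrow> 'a \<Rightarrow> real) \<Rightarrow> nat ^ 'd \<Rightarrow> real ^ 'd \<Rightarrow> 'a \<Rightarrow> complex" where
  "dft X n t \<omega> =
     (\<Sum>k\<in>lattice_box n. exp (\<i> * complex_of_real (freq_dot k t)) * complex_of_real (X k \<omega>))"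

text \<open>Note the cut-off at 1 instead of the more common 0. At \<open>x = 0\<close> the library convention \<open>ln 0 = 0\<close>
  gives the value 1.\<close>

definition log_plus :: "real \<Rightarrow> real" where
  "log_plus x = max 1 (ln x)"

text \<open>The diagonal point \<open>(n, \<dots>, n)\<close>.\<close>

definition diag :: "nat \<Rightarrow> nat ^ 'd" where
  "diag n = (\<chi> i. n)"

end

(* Let d = CARD('d). For l^2 <= n < (l + 1)^2 truncate the variables at level l^(1/4). The truncated
   sum over the box of side l^2 has L^2 norm over torus x Omega at most of order l^d * l^(1/4) by
   Parseval, so after division by l^(2d) its squared norm is O(l^(-3/2)), which is summable in l.
   Passing from side l^2 to n costs at most l^(1/4) * ((l + 1)^(2d) - l^(2d)) = o(l^(2d)).
   The part above the truncation level is bounded in absolute value, along dyadic blocks of l; the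
   resulting series sum_j E[|X|; |X| > 2^(j/4)] converges because E[|X| log |X|] is finite. *)

theory Submission
  imports Defs "HOL-Real_Asymp.Real_Asymp" "HOL-Library.Discrete_Functions"
begin

section \<open>Lattice boxes and the number of their points\<close>

lemma card_lattice_box: "card (lattice_box n) = lattice_vol n"
  for n :: "nat ^ 'd"
proof -
  have "bij_betw vec_nth (lattice_box n) (\<Pi>\<^sub>E i\<in>UNIV. {1..n $ i})"
    by (rule bij_betw_byWitness[where f' = vec_lambda])
      (auto simp: lattice_box_def pos_lattice_def less_eq_vec_def vec_lambda_inverse PiE_iff)
  then show ?thesis
    by (simp add: bij_betw_same_card card_PiE lattice_vol_def)
qed

lemma lattice_vol_diag: "lattice_vol (diag n :: nat ^ 'd) = n ^ CARD('d)"
  by (simp add: lattice_vol_def diag_def)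

lemma lattice_box_diag_mono: "m \<le> n \<Longrightarrow> lattice_box (diag m :: nat ^ 'd) \<subseteq> lattice_box (diag n)"
  by (fastforce simp: lattice_box_def diag_def less_eq_vec_def intro: order_trans)

lemma diag_mem_pos_lattice: "1 \<le> n \<Longrightarrow> diag n \<in> pos_lattice"
  by (simp add: pos_lattice_def diag_def)

section \<open>Orthogonality of exponentials on the torus and Parseval's identity\<close>

lemma
  fixes f :: "'d::finite \<Rightarrow> real \<Rightarrow> complex"
  assumes int: "\<And>i. integrable lborel (f i)"
  shows integrable_lborel_prod_vec:
      "integrable lborel (\<lambda>t::real ^ 'd. \<Prod>i\<in>UNIV. f i (t $ i))" (is ?int)
    and integral_lborel_prod_vec:
      "(LINT t|lborel. (\<Prod>i\<in>UNIV. f i ((t::real ^ 'd) $ i))) = (\<Prod>i\<in>UNIV. (LINT x|lborel. f i x))" (is ?eq)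
proof -
  interpret product_sigma_finite "\<lambda>b::real^'d. lborel :: real measure"
    by standard
  have bij: "bij_betw (\<lambda>i. axis i 1 :: real ^ 'd) UNIV Basis"
    by (auto simp: bij_betw_def inj_on_def axis_eq_axis Basis_vec_def)
  \<comment> \<open>\<open>lborel\<close> on \<open>real ^ 'd\<close> is the image of a product
    measure indexed by \<open>Basis\<close>, not by \<open>'d\<close>. Hence the factors
    \<open>f i\<close> are relabelled along \<open>i \<mapsto> axis i 1\<close> before the product
    rule for integrals is applied.\<close>
  define g where "g b = f (inv_into UNIV (\<lambda>i. axis i 1 :: real ^ 'd) b)" for b
  have g_axis: "g (axis i 1) = f i" for i
    using bij_betw_inv_into_left[OF bij, of i] by (simp add: g_def)
  have int_g: "integrable lborel (g b)" for b
    using int by (simp add: g_def)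
  have [measurable]: "f i \<in> borel_measurable borel" for i
    using borel_measurable_integrable[OF int[of i]] by simp
  have eq: "(\<Prod>i\<in>UNIV. f i ((\<Sum>b\<in>Basis. x b *\<^sub>R b) $ i)) = (\<Prod>b\<in>Basis. g b (x b))" for x :: "real ^ 'd \<Rightarrow> real"
  proof -
    have "(\<Sum>b\<in>Basis. x b *\<^sub>R b) $ i = x (axis i 1)" for i
    proof -
      have "(\<Sum>b\<in>Basis. x b *\<^sub>R b) $ i = (\<Sum>b\<in>Basis. x b *\<^sub>R b) \<bullet> axis i 1"
        by (simp add: inner_axis)
      also have "\<dots> = x (axis i 1)"
        by (simp add: axis_in_Basis_iff)
      finally show ?thesis .
    qed
    then have "(\<Prod>i\<in>UNIV. f i ((\<Sum>b\<in>Basis. x b *\<^sub>R b) $ i)) = (\<Prod>i\<in>UNIV. g (axis i 1) (x (axis i 1)))"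
      by (simp add: g_axis)
    also have "\<dots> = (\<Prod>b\<in>Basis. g b (x b))"
      by (rule prod.reindex_bij_betw[OF bij])
    finally show ?thesis .
  qed
  have meas: "(\<lambda>x. \<Sum>b\<in>Basis. x b *\<^sub>R b) \<in> measurable (\<Pi>\<^sub>M b\<in>Basis. lborel) (borel :: (real ^ 'd) measure)"
    by simp
  define h where "h t = (\<Prod>i\<in>UNIV. f i (t $ i))" for t :: "real ^ 'd"
  have [measurable]: "h \<in> borel_measurable borel"
    unfolding h_def by simp
  have "integrable (\<Pi>\<^sub>M b\<in>Basis. lborel) (\<lambda>x. h (\<Sum>b\<in>Basis. x b *\<^sub>R b))"
    unfolding h_def eq by (intro product_integrable_prod finite_Basis int_g)
  then show ?int
    unfolding h_def[symmetric] by (subst lborel_eq, subst integrable_distr_eq[OF meas]) simp_all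
  have "(LINT t|lborel. (\<Prod>i\<in>UNIV. f i ((t::real ^ 'd) $ i))) = (\<Prod>b\<in>(Basis :: (real ^ 'd) set). (LINT x|lborel. g b x))"
  proof -
    have "integral\<^sup>L lborel h = (LINT x|(\<Pi>\<^sub>M b\<in>Basis. lborel). h (\<Sum>b\<in>Basis. x b *\<^sub>R b))"
      by (subst lborel_eq, subst integral_distr[OF meas]) simp_all
    then show ?thesis
      unfolding h_def eq by (subst (asm) product_integral_prod) (auto intro: int_g)
  qed
  also have "\<dots> = (\<Prod>i\<in>UNIV. (LINT x|lborel. f i x))"
    by (subst prod.reindex_bij_betw[OF bij, symmetric]) (simp add: g_axis)
  finally show ?eq .
qed

lemma borel_measurable_cis [measurable]: "cis \<in> borel_measurable borel"
  by (intro borel_measurable_continuous_onI continuous_intros)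

lemma has_bochner_integral_cis_period:
  "has_bochner_integral lborel (\<lambda>x. indicator {- pi..<pi} x *\<^sub>R cis (of_int m * x))
     (if m = 0 then of_real (2 * pi) else 0)"
proof -
  \<comment> \<open>The fundamental theorem of calculus is applied on the closed interval; the
    half-open one differs from it by the null set \<open>{pi}\<close>.\<close>
  have *: "has_bochner_integral lborel (\<lambda>x. indicator {- pi..pi} x *\<^sub>R cis (of_int m * x))
     (if m = 0 then of_real (2 * pi) else 0)"
  proof (cases "m = 0")
    case True
    then show ?thesis
      using has_bochner_integral_scaleR_left[of 1 lborel "indicator {-pi..pi}" "2 * pi"]
      by (simp add: has_bochner_integral_iff scaleR_conv_of_real)
  next
    case False
    define F where "F x = cis (of_int m * x) / (\<i> * of_int m)" for x :: real
    have "(F has_vector_derivative cis (of_int m * x)) (at x within {- pi..pi})" for x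
    proof -
      have "((\<lambda>z. exp (\<i> * of_int m * z) / (\<i> * of_int m)) has_field_derivative exp (\<i> * of_int m * of_real x)) (at (of_real x))"
        using False by (auto intro!: derivative_eq_intros)
      from has_vector_derivative_real_field[OF this] show ?thesis
        unfolding F_def cis_conv_exp by (simp add: mult.assoc)
    qed
    moreover have "continuous_on {- pi..pi} (\<lambda>x. cis (of_int m * x))"
      by (intro continuous_intros)
    ultimately have "has_bochner_integral lborel (\<lambda>x. indicator {- pi..pi} x *\<^sub>R cis (of_int m * x)) (F pi - F (- pi))"
      by (intro has_bochner_integral_FTC_Icc) auto
    moreover have "F pi = F (- pi)"
    proof -
      \<comment> \<open>The two endpoints differ by a full period: the last factor is 1 because
        \<open>m\<close> is an integer.\<close>
      have "cis (of_int m * pi) = cis (of_int m * (- pi)) * cis (2 * pi * of_int m)"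
        by (simp add: cis_mult algebra_simps)
      then show ?thesis
        by (simp add: F_def)
    qed
    ultimately show ?thesis
      using False by simp
  qed
  have "AE x in lborel. x \<noteq> pi"
    by (rule AE_lborel_singleton)
  then have "AE x in lborel. indicator {- pi..pi} x *\<^sub>R cis (of_int m * x) = indicator {- pi..<pi} x *\<^sub>R cis (of_int m * x)"
    by (rule AE_mp) (auto simp: indicator_def)
  with * show ?thesis
    by (subst has_bochner_integral_cong_AE[symmetric]) auto
qed

text \<open>The integrand factorizes over the coordinates into one-dimensional exponentials of
  integer frequency, so a single coordinate in which \<open>k\<close> and \<open>k'\<close> differ
  makes the whole integral vanish.\<close>

lemma has_bochner_integral_cis_torus:
  fixes k k' :: "nat ^ 'd"
  shows "has_bochner_integral lborel
     (\<lambda>t. indicator torus t *\<^sub>R (cis (freq_dot k t) * cnj (cis (freq_dot k' t))))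
     (if k = k' then of_real ((2 * pi) ^ CARD('d)) else 0)"
proof -
  \<comment> \<open>The casts to \<open>int\<close> precede the subtraction, since a difference of
    naturals would be cut off at 0.\<close>
  define f where "f i x = (indicator {- pi..<pi} x *\<^sub>R cis (of_int (int (k $ i) - int (k' $ i)) * x) :: complex)" for i and x :: real
  have f: "has_bochner_integral lborel (f i) (if k $ i = k' $ i then of_real (2 * pi) else 0)" for i
    using has_bochner_integral_cis_period[of "int (k $ i) - int (k' $ i)"]
    unfolding f_def by simp
  have cis_sum: "cis (sum g A) = (\<Prod>i\<in>A. cis (g i))" if "finite A" for g :: "'d \<Rightarrow> real" and A
    using that by induction (auto simp: cis_mult[symmetric])
  have ind: "indicator torus t = (\<Prod>i\<in>UNIV. indicator {- pi..<pi} (t $ i) :: real)" for t :: "real ^ 'd"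
  proof (cases "t \<in> torus")
    case False
    then obtain i where "t $ i \<notin> {- pi..<pi}"
      by (auto simp: torus_def)
    then have "\<exists>i. indicator {- pi..<pi} (t $ i) = (0 :: real)"
      by (intro exI[of _ i]) simp
    then have "(\<Prod>i\<in>UNIV. indicator {- pi..<pi} (t $ i)) = (0 :: real)"
      by (intro prod_zero) auto
    with False show ?thesis by simp
  qed (simp add: torus_def indicator_def)
  have "indicator torus t *\<^sub>R (cis (freq_dot k t) * cnj (cis (freq_dot k' t))) = (\<Prod>i\<in>UNIV. f i (t $ i))" for t
  proof -
    have "freq_dot k t - freq_dot k' t = (\<Sum>i\<in>UNIV. of_int (int (k $ i) - int (k' $ i)) * t $ i)"
      by (simp add: freq_dot_def left_diff_distrib flip: sum_subtractf)
    then have "cis (freq_dot k t) * cnj (cis (freq_dot k' t))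
        = cis (\<Sum>i\<in>UNIV. of_int (int (k $ i) - int (k' $ i)) * t $ i)"
      by (simp add: cis_cnj cis_mult)
    then show ?thesis
      by (simp only: cis_sum finite_class.finite_UNIV ind f_def scaleR_conv_of_real prod.distrib of_real_prod)
  qed
  moreover have "(\<Prod>i\<in>UNIV. (LINT x|lborel. f i x)) = (if k = k' then of_real ((2 * pi) ^ CARD('d)) else 0)"
  proof (cases "k = k'")
    case False
    then obtain i where "k $ i \<noteq> k' $ i"
      by (auto simp: vec_eq_iff)
    with False show ?thesis
      using has_bochner_integral_integral_eq[OF f[of i]] by (subst prod_zero) auto
  qed (simp add: has_bochner_integral_integral_eq[OF f])
  ultimately show ?thesis
    using f by (simp add: has_bochner_integral_iff integrable_lborel_prod_vec integral_lborel_prod_vec)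
qed

text \<open>Expanding the squared modulus gives a double sum of which orthogonality leaves only the
  diagonal. The nonnegative integral is the form that Tonelli's theorem needs later, when \<omega>
  is integrated as well.\<close>

lemma Parseval_torus:
  fixes A :: "(nat ^ 'd) set" and c :: "nat ^ 'd \<Rightarrow> real"
  assumes "finite A"
  shows "(\<integral>\<^sup>+t\<in>torus. ennreal ((cmod (\<Sum>k\<in>A. cis (freq_dot k t) * of_real (c k)))\<^sup>2) \<partial>lborel)
       = ennreal ((2 * pi) ^ CARD('d) * (\<Sum>k\<in>A. (c k)\<^sup>2))"
proof -
  define F where "F t = (\<Sum>k\<in>A. cis (freq_dot k t) * of_real (c k))" for t
  \<comment> \<open>The expansion of \<open>F t * cnj (F t)\<close>, with the indicator moved
    inside. It is complex-valued but real at every point, so taking real parts recovers the squared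
    modulus.\<close>
  define G where "G t = (\<Sum>k\<in>A. \<Sum>k'\<in>A. of_real (c k * c k') *
     (indicator torus t *\<^sub>R (cis (freq_dot k t) * cnj (cis (freq_dot k' t)))))" for t
  have FG: "of_real (indicator torus t * (cmod (F t))\<^sup>2) = G t" for t
  proof -
    have "F t * cnj (F t) = (\<Sum>k\<in>A. \<Sum>k'\<in>A. (cis (freq_dot k t) * of_real (c k)) * (cnj (cis (freq_dot k' t)) * of_real (c k')))"
      by (simp add: F_def sum_product)
    then show ?thesis
      unfolding of_real_mult complex_norm_square G_def
      by (simp add: sum_distrib_left scaleR_conv_of_real mult_ac)
  qed
  have G: "has_bochner_integral lborel G
    (\<Sum>k\<in>A. \<Sum>k'\<in>A. of_real (c k * c k') * (if k = k' then of_real ((2 * pi) ^ CARD('d)) else 0))"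
    unfolding G_def
    by (intro has_bochner_integral_sum has_bochner_integral_mult_right has_bochner_integral_cis_torus)
  also have "(\<Sum>k\<in>A. \<Sum>k'\<in>A. of_real (c k * c k') * (if k = k' then of_real ((2 * pi) ^ CARD('d)) else 0))
     = complex_of_real ((2 * pi) ^ CARD('d) * (\<Sum>k\<in>A. (c k)\<^sup>2))"
    using assms by (simp add: if_distrib[where f = "\<lambda>z. _ * z"] sum.delta sum_distrib_left power2_eq_square mult_ac cong: if_cong)
  finally have "has_bochner_integral lborel (\<lambda>t. Re (G t)) (Re (complex_of_real ((2 * pi) ^ CARD('d) * (\<Sum>k\<in>A. (c k)\<^sup>2))))"
    by (rule has_bochner_integral_Re)
  also have "(\<lambda>t. Re (G t)) = (\<lambda>t. indicator torus t * (cmod (F t))\<^sup>2)"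
    by (simp flip: FG)
  finally have "(\<integral>\<^sup>+t. ennreal (indicator torus t * (cmod (F t))\<^sup>2) \<partial>lborel)
      = ennreal ((2 * pi) ^ CARD('d) * (\<Sum>k\<in>A. (c k)\<^sup>2))"
    by (subst nn_integral_eq_integral) (auto simp: has_bochner_integral_iff)
  also have "(\<integral>\<^sup>+t. ennreal (indicator torus t * (cmod (F t))\<^sup>2) \<partial>lborel)
      = (\<integral>\<^sup>+t\<in>torus. ennreal ((cmod (F t))\<^sup>2) \<partial>lborel)"
    by (intro nn_integral_cong) (simp add: indicator_def)
  finally show ?thesis
    by (simp only: F_def)
qed

section \<open>Almost everywhere convergence from summable integrals\<close>

lemma AE_tendsto_0_of_summable_nn_integral:
  fixes f :: "nat \<Rightarrow> 'a \<Rightarrow> real"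
  assumes [measurable]: "\<And>n. f n \<in> borel_measurable M"
    and nonneg: "\<And>n x. 0 \<le> f n x"
    and fin: "(\<Sum>n. \<integral>\<^sup>+x. ennreal (f n x) \<partial>M) < \<infinity>"
  shows "AE x in M. (\<lambda>n. f n x) \<longlonglongrightarrow> 0"
proof -
  \<comment> \<open>By monotone convergence the sum of all \<open>f n\<close> has a finite integral.
    It is therefore finite almost everywhere, and there the terms of the series tend to 0.\<close>
  have "(\<integral>\<^sup>+x. (\<Sum>n. ennreal (f n x)) \<partial>M) \<noteq> \<infinity>"
    using fin by (subst nn_integral_suminf) auto
  then have "AE x in M. (\<Sum>n. ennreal (f n x)) \<noteq> \<infinity>"
    by (intro nn_integral_PInf_AE) auto
  then show ?thesis
    by (rule AE_mp) (auto intro!: summable_LIMSEQ_zero summable_suminf_not_top nonneg)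
qed

section \<open>Truncation, and the contribution above the truncation level\<close>

definition excess :: "real \<Rightarrow> real \<Rightarrow> real" where
  "excess a x = (if a < \<bar>x\<bar> then \<bar>x\<bar> else 0)"

text \<open>Large values are replaced by 0 instead of being clipped to the level. Thus
  \<open>excess a x\<close> is exactly the absolute value of the discarded part
  \<open>x - truncate a x\<close>.\<close>

definition truncate :: "real \<Rightarrow> real \<Rightarrow> real" where
  "truncate a x = (if a < \<bar>x\<bar> then 0 else x)"

lemma excess_nonneg: "0 \<le> excess a x"
  by (simp add: excess_def)

lemma excess_antimono: "a \<le> b \<Longrightarrow> excess b x \<le> excess a x"
  by (simp add: excess_def)

lemma abs_truncate_le: "0 \<le> a \<Longrightarrow> \<bar>truncate a x\<bar> \<le> a"
  by (simp add: truncate_def)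

lemma measurable_excess [measurable]: "excess a \<in> borel_measurable borel"
  unfolding excess_def by measurable

lemma measurable_truncate [measurable]: "truncate a \<in> borel_measurable borel"
  unfolding truncate_def by measurable

text \<open>Layer cake formula: \<open>excess a y\<close> is the length of the set of
  \<open>x \<ge> 0\<close> with \<open>max x a < \<bar>y\<bar>\<close>, which is
  \<open>{0..<\<bar>y\<bar>}\<close> or empty. Expectations are thereby expressed through tail
  probabilities, the only quantities that the domination hypothesis controls.\<close>

lemma (in prob_space) nn_integral_excess:
  assumes [measurable]: "X \<in> borel_measurable M" and "0 \<le> a"
  shows "(\<integral>\<^sup>+\<omega>. ennreal (excess a (X \<omega>)) \<partial>M)
       = (\<integral>\<^sup>+x\<in>{0..}. ennreal (\<P>(\<omega> in M. max x a < \<bar>X \<omega>\<bar>)) \<partial>lborel)"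
proof -
  interpret pair_sigma_finite "lborel :: real measure" M ..
  have pt: "ennreal (excess a y) = (\<integral>\<^sup>+x. indicator {0..} x * indicator {x. max x a < \<bar>y\<bar>} x \<partial>lborel)" for y
  proof -
    have "(\<integral>\<^sup>+x. indicator {0..} x * indicator {x. max x a < \<bar>y\<bar>} x \<partial>lborel)
        = (\<integral>\<^sup>+x. indicator (if a < \<bar>y\<bar> then {0..<\<bar>y\<bar>} else {}) x \<partial>(lborel :: real measure))"
      using \<open>0 \<le> a\<close> by (intro nn_integral_cong) (auto simp: indicator_def)
    also have "\<dots> = ennreal (excess a y)"
      by (simp add: excess_def)
    finally show ?thesis ..
  qed
  have "(\<integral>\<^sup>+\<omega>. ennreal (excess a (X \<omega>)) \<partial>M)
      = (\<integral>\<^sup>+x. (\<integral>\<^sup>+\<omega>. indicator {0..} x * indicator {x. max x a < \<bar>X \<omega>\<bar>} x \<partial>M) \<partial>lborel)"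
    unfolding pt by (rule Fubini') (simp add: indicator_def case_prod_unfold)
  also have "\<dots> = (\<integral>\<^sup>+x\<in>{0..}. ennreal (\<P>(\<omega> in M. max x a < \<bar>X \<omega>\<bar>)) \<partial>lborel)"
  proof (intro nn_integral_cong)
    fix x :: real
    have "(\<integral>\<^sup>+\<omega>. indicator {0..} x * indicator {x. max x a < \<bar>X \<omega>\<bar>} x \<partial>M)
        = (\<integral>\<^sup>+\<omega>. indicator {0..} x * indicator {\<omega>\<in>space M. max x a < \<bar>X \<omega>\<bar>} \<omega> \<partial>M)"
      by (intro nn_integral_cong) (auto simp: indicator_def)
    also have "\<dots> = indicator {0..} x * emeasure M {\<omega>\<in>space M. max x a < \<bar>X \<omega>\<bar>}"
      by (subst nn_integral_cmult) auto
    finally show "(\<integral>\<^sup>+\<omega>. indicator {0..} x * indicator {x. max x a < \<bar>X \<omega>\<bar>} x \<partial>M)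
        = ennreal (\<P>(\<omega> in M. max x a < \<bar>X \<omega>\<bar>)) * indicator {0..} x"
      by (simp add: emeasure_eq_measure mult.commute)
  qed
  finally show ?thesis .
qed

text \<open>Each level \<open>2 powr (real j / 4)\<close> below \<open>\<bar>x\<bar>\<close>
  contributes \<open>\<bar>x\<bar>\<close>, and the number of such levels grows like the logarithm
  of \<open>\<bar>x\<bar>\<close>. This is where the logarithm in the moment condition comes
  from.\<close>

lemma sum_excess_le_log:
  assumes "finite J"
  shows "(\<Sum>j\<in>J. excess (2 powr (real j / 4)) x) \<le> 8 * (\<bar>x\<bar> * log_plus \<bar>x\<bar>)"
proof -
  define K where "K = {j\<in>J. 2 powr (real j / 4) < \<bar>x\<bar>}"
  have "(\<Sum>j\<in>J. excess (2 powr (real j / 4)) x) = real (card K) * \<bar>x\<bar>"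
    using assms by (simp add: K_def excess_def sum.If_cases Int_def)
  also have "\<dots> \<le> (8 * log_plus \<bar>x\<bar>) * \<bar>x\<bar>"
  proof (cases "1 < \<bar>x\<bar>")
    case True
    have "j < nat \<lceil>4 * log 2 \<bar>x\<bar>\<rceil>" if "j \<in> K" for j
    proof -
      have "real j / 4 < log 2 \<bar>x\<bar>"
        using that True by (subst less_log_iff) (auto simp: K_def)
      then show ?thesis by linarith
    qed
    then have "card K \<le> card {..<nat \<lceil>4 * log 2 \<bar>x\<bar>\<rceil>}"
      by (intro card_mono) auto
    moreover have "0 < log 2 \<bar>x\<bar>"
      using True by simp
    \<comment> \<open>Rounding up costs the summand 1. As \<open>ln 2\<close> is at least 2/3, the
      factor \<open>4 / ln 2\<close> is at most 6, hence below 7; the remaining 1 is absorbed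
      because \<open>log_plus\<close> is at least 1, which gives 8.\<close>
    ultimately have "real (card K) \<le> 4 * log 2 \<bar>x\<bar> + 1"
      by (simp only: card_lessThan) linarith
    also have "4 * log 2 \<bar>x\<bar> = (4 / ln 2) * ln \<bar>x\<bar>"
      by (simp add: log_def)
    also have "\<dots> \<le> 7 * ln \<bar>x\<bar>"
    proof (rule mult_right_mono)
      show "4 / ln 2 \<le> (7::real)"
        using ln2_ge_two_thirds by (simp add: field_simps)
    qed (use True in auto)
    also have "\<dots> \<le> 7 * log_plus \<bar>x\<bar>"
      by (simp add: log_plus_def)
    finally have "real (card K) \<le> 8 * log_plus \<bar>x\<bar>"
      by (simp add: log_plus_def)
    then show ?thesis
      by (simp add: mult_right_mono)
  next
    case False
    \<comment> \<open>All levels are at least 1, so a value with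
      \<open>\<bar>x\<bar> \<le> 1\<close> exceeds none of them and the sum is empty.\<close>
    moreover have "1 \<le> 2 powr (real j / 4)" for j
      by (rule ge_one_powr_ge_zero) auto
    ultimately have "K = {}"
      unfolding K_def by (smt (verit, best) Collect_empty_eq)
    then show ?thesis
      by (simp add: log_plus_def)
  qed
  finally show ?thesis
    by (simp add: mult_ac)
qed

text \<open>The layer cake formula, applied on both sides, turns domination of tails into domination
  of expectations. The box \<open>n\<close> is fixed, and \<open>C\<close> includes its
  volume.\<close>

lemma (in prob_space) sum_nn_integral_excess_le:
  fixes Xs :: "nat ^ 'd \<Rightarrow> 'a \<Rightarrow> real" and C :: real
  assumes [measurable]: "X \<in> borel_measurable M"
    and Xs: "\<And>n. n \<in> pos_lattice \<Longrightarrow> Xs n \<in> borel_measurable M"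
    and "0 \<le> C"
    and tail: "\<And>x. 0 \<le> x \<Longrightarrow>
           (\<Sum>k\<in>lattice_box n. \<P>(\<omega> in M. x < \<bar>Xs k \<omega>\<bar>)) \<le> C * \<P>(\<omega> in M. x < \<bar>X \<omega>\<bar>)"
    and "0 \<le> a"
  shows "(\<integral>\<^sup>+\<omega>. ennreal (\<Sum>k\<in>lattice_box n. excess a (Xs k \<omega>)) \<partial>M)
       \<le> ennreal C * (\<integral>\<^sup>+\<omega>. ennreal (excess a (X \<omega>)) \<partial>M)"
proof -
  have m: "Xs k \<in> borel_measurable M" if "k \<in> lattice_box n" for k
    using that Xs by (auto simp: lattice_box_def)
  have tail_m: "(\<lambda>x. ennreal (\<P>(\<omega> in M. max x a < \<bar>Y \<omega>\<bar>))) \<in> borel_measurable borel"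
    if [measurable]: "Y \<in> borel_measurable M" for Y
    by measurable
  have "(\<integral>\<^sup>+\<omega>. ennreal (\<Sum>k\<in>lattice_box n. excess a (Xs k \<omega>)) \<partial>M)
      = (\<integral>\<^sup>+\<omega>. (\<Sum>k\<in>lattice_box n. ennreal (excess a (Xs k \<omega>))) \<partial>M)"
    by (simp add: sum_ennreal excess_nonneg)
  also have "\<dots> = (\<Sum>k\<in>lattice_box n. \<integral>\<^sup>+\<omega>. ennreal (excess a (Xs k \<omega>)) \<partial>M)"
    using m by (intro nn_integral_sum) measurable
  also have "\<dots> = (\<Sum>k\<in>lattice_box n. \<integral>\<^sup>+x\<in>{0..}. ennreal (\<P>(\<omega> in M. max x a < \<bar>Xs k \<omega>\<bar>)) \<partial>lborel)"
    using m \<open>0 \<le> a\<close> by (intro sum.cong nn_integral_excess) auto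
  also have "\<dots> = (\<integral>\<^sup>+x. (\<Sum>k\<in>lattice_box n. ennreal (\<P>(\<omega> in M. max x a < \<bar>Xs k \<omega>\<bar>)) * indicator {0..} x) \<partial>lborel)"
    using m tail_m by (intro nn_integral_sum[symmetric]) auto
  also have "\<dots> \<le> (\<integral>\<^sup>+x. ennreal C * (ennreal (\<P>(\<omega> in M. max x a < \<bar>X \<omega>\<bar>)) * indicator {0..} x) \<partial>lborel)"
  proof (rule nn_integral_mono)
    fix x :: real
    have "(\<Sum>k\<in>lattice_box n. \<P>(\<omega> in M. max x a < \<bar>Xs k \<omega>\<bar>)) \<le> C * \<P>(\<omega> in M. max x a < \<bar>X \<omega>\<bar>)"
      using \<open>0 \<le> a\<close> by (intro tail) simp
    then show "(\<Sum>k\<in>lattice_box n. ennreal (\<P>(\<omega> in M. max x a < \<bar>Xs k \<omega>\<bar>)) * indicator {0..} x)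
        \<le> ennreal C * (ennreal (\<P>(\<omega> in M. max x a < \<bar>X \<omega>\<bar>)) * indicator {0..} x)"
      using \<open>0 \<le> C\<close>
      by (auto simp: indicator_def sum_ennreal ennreal_leI simp flip: ennreal_mult)
  qed
  also have "\<dots> = ennreal C * (\<integral>\<^sup>+\<omega>. ennreal (excess a (X \<omega>)) \<partial>M)"
    using tail_m[of X] \<open>0 \<le> a\<close> by (subst nn_integral_cmult) (auto simp: nn_integral_excess)
  finally show ?thesis .
qed

text \<open>Summing the expectations over every \<open>l\<close> would require a power moment,
  because about \<open>\<bar>x\<bar>\<close> to the fourth levels \<open>real l powr (1/4)\<close>
  lie below \<open>\<bar>x\<bar>\<close>. One majorant per dyadic block of \<open>l\<close> leaves
  only logarithmically many levels.\<close>

lemma (in prob_space) AE_excess_average_tendsto_0: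
  fixes Xs :: "nat ^ 'd \<Rightarrow> 'a \<Rightarrow> real" and C :: real
  assumes [measurable]: "X \<in> borel_measurable M"
    and Xs: "\<And>n. n \<in> pos_lattice \<Longrightarrow> Xs n \<in> borel_measurable M"
    and "0 \<le> C"
    and tail: "\<And>x n. 0 \<le> x \<Longrightarrow> n \<in> pos_lattice \<Longrightarrow>
           (\<Sum>k\<in>lattice_box n. \<P>(\<omega> in M. x < \<bar>Xs k \<omega>\<bar>))
             \<le> C * real (lattice_vol n) * \<P>(\<omega> in M. x < \<bar>X \<omega>\<bar>)"
    and int: "integrable M (\<lambda>\<omega>. \<bar>X \<omega>\<bar> * log_plus \<bar>X \<omega>\<bar>)"
  shows "AE \<omega> in M. (\<lambda>l. (\<Sum>k\<in>lattice_box (diag ((l + 1)\<^sup>2)). excess (real l powr (1/4)) (Xs k \<omega>))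
            / real l ^ (2 * CARD('d))) \<longlonglongrightarrow> 0"
proof -
  \<comment> \<open>Majorant for the block from \<open>2 ^ j\<close> to below
    \<open>2 ^ Suc j\<close>: the box side \<open>(l + 1)\<^sup>2\<close> is raised to
    \<open>4 ^ Suc j\<close>, the level is lowered to its value at \<open>2 ^ j\<close>, and so is
    the denominator.\<close>
  define V where "V j \<omega> = (\<Sum>k\<in>lattice_box (diag (4 ^ Suc j)). excess (2 powr (real j / 4)) (Xs k \<omega>))
      / 4 ^ (j * CARD('d))" for j \<omega>
  have m: "Xs k \<in> borel_measurable M" if "k \<in> lattice_box n" for k n
    using that Xs by (auto simp: lattice_box_def)
  have "AE \<omega> in M. (\<lambda>j. V j \<omega>) \<longlonglongrightarrow> 0"
  proof (rule AE_tendsto_0_of_summable_nn_integral)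
    show "V j \<in> borel_measurable M" for j
      unfolding V_def using m by measurable
    show "0 \<le> V j \<omega>" for j \<omega>
      by (simp add: V_def sum_nonneg excess_nonneg)
    have V_le: "(\<integral>\<^sup>+\<omega>. ennreal (V j \<omega>) \<partial>M)
        \<le> ennreal (C * 4 ^ CARD('d)) * (\<integral>\<^sup>+\<omega>. ennreal (excess (2 powr (real j / 4)) (X \<omega>)) \<partial>M)" for j
    proof -
      let ?S = "\<lambda>\<omega>. \<Sum>k\<in>lattice_box (diag (4 ^ Suc j)). excess (2 powr (real j / 4)) (Xs k \<omega>)"
      have "(\<integral>\<^sup>+\<omega>. ennreal (V j \<omega>) \<partial>M)
          = (\<integral>\<^sup>+\<omega>. ennreal (1 / 4 ^ (j * CARD('d))) * ennreal (?S \<omega>) \<partial>M)"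
        by (simp add: V_def flip: ennreal_mult')
      also have "\<dots> = ennreal (1 / 4 ^ (j * CARD('d))) * (\<integral>\<^sup>+\<omega>. ennreal (?S \<omega>) \<partial>M)"
        using m by (intro nn_integral_cmult) measurable
      also have "(\<integral>\<^sup>+\<omega>. ennreal (?S \<omega>) \<partial>M)
          \<le> ennreal (C * real (lattice_vol (diag (4 ^ Suc j) :: nat ^ 'd)))
            * (\<integral>\<^sup>+\<omega>. ennreal (excess (2 powr (real j / 4)) (X \<omega>)) \<partial>M)"
        using \<open>0 \<le> C\<close> by (intro sum_nn_integral_excess_le Xs tail diag_mem_pos_lattice) auto
      also have "ennreal (1 / 4 ^ (j * CARD('d))) * (ennreal (C * real (lattice_vol (diag (4 ^ Suc j) :: nat ^ 'd)))
            * (\<integral>\<^sup>+\<omega>. ennreal (excess (2 powr (real j / 4)) (X \<omega>)) \<partial>M))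
          = ennreal (C * 4 ^ CARD('d)) * (\<integral>\<^sup>+\<omega>. ennreal (excess (2 powr (real j / 4)) (X \<omega>)) \<partial>M)"
      proof -
        \<comment> \<open>The enlarged box has \<open>4 ^ CARD('d)\<close> times as many points as
          the denominator of \<open>V j\<close>, a ratio that does not depend on
          \<open>j\<close>.\<close>
        have "real (lattice_vol (diag (4 ^ Suc j) :: nat ^ 'd)) = 4 ^ (j * CARD('d)) * 4 ^ CARD('d)"
          by (simp add: lattice_vol_diag power_mult_distrib power_mult[symmetric] mult.commute)
        then have "1 / 4 ^ (j * CARD('d)) * (C * real (lattice_vol (diag (4 ^ Suc j) :: nat ^ 'd))) = C * 4 ^ CARD('d)"
          by simp
        then show ?thesis
          using \<open>0 \<le> C\<close> by (simp only: mult.assoc[symmetric] ennreal_mult'[symmetric] zero_le_divide_1_iff zero_le_power zero_le_numeral)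
      qed
      finally show ?thesis
        by (simp add: mult_left_mono)
    qed
    have "(\<Sum>j. ennreal (excess (2 powr (real j / 4)) x)) \<le> ennreal (8 * (\<bar>x\<bar> * log_plus \<bar>x\<bar>))" for x
      by (rule suminf_le_const) (auto simp: sum_ennreal excess_nonneg intro!: ennreal_leI sum_excess_le_log)
    then have "(\<integral>\<^sup>+\<omega>. (\<Sum>j. ennreal (excess (2 powr (real j / 4)) (X \<omega>))) \<partial>M)
        \<le> (\<integral>\<^sup>+\<omega>. ennreal (8 * (\<bar>X \<omega>\<bar> * log_plus \<bar>X \<omega>\<bar>)) \<partial>M)"
      by (intro nn_integral_mono) auto
    also have "\<dots> < \<infinity>"
    proof -
      have "integrable M (\<lambda>\<omega>. 8 * (\<bar>X \<omega>\<bar> * log_plus \<bar>X \<omega>\<bar>))"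
        using int by simp
      then show ?thesis
        by (subst nn_integral_eq_integral) (auto simp: log_plus_def)
    qed
    finally have fin: "(\<Sum>j. \<integral>\<^sup>+\<omega>. ennreal (excess (2 powr (real j / 4)) (X \<omega>)) \<partial>M) < \<infinity>"
      by (subst nn_integral_suminf[symmetric]) measurable
    have "(\<Sum>j. \<integral>\<^sup>+\<omega>. ennreal (V j \<omega>) \<partial>M)
        \<le> (\<Sum>j. ennreal (C * 4 ^ CARD('d)) * (\<integral>\<^sup>+\<omega>. ennreal (excess (2 powr (real j / 4)) (X \<omega>)) \<partial>M))"
      by (intro suminf_le V_le) auto
    also have "\<dots> < \<infinity>"
      using fin by (simp add: ennreal_mult_less_top)
    finally show "(\<Sum>j. \<integral>\<^sup>+\<omega>. ennreal (V j \<omega>) \<partial>M) < \<infinity>" .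
  qed
  then show ?thesis
  proof eventually_elim
    case (elim \<omega>)
    moreover have "filterlim floor_log at_top sequentially"
      by (rule filterlim_at_top_at_top[where P = "\<lambda>_. True" and Q = "\<lambda>_. True" and g = "\<lambda>n. 2 ^ n"])
        (auto intro: monoD[OF floor_log_mono])
    ultimately have lim: "(\<lambda>l. V (floor_log l) \<omega>) \<longlonglongrightarrow> 0"
      by (rule filterlim_compose)
    show "(\<lambda>l. (\<Sum>k\<in>lattice_box (diag ((l + 1)\<^sup>2)). excess (real l powr (1/4)) (Xs k \<omega>))
            / real l ^ (2 * CARD('d))) \<longlonglongrightarrow> 0"
    proof (rule tendsto_sandwich[OF _ _ tendsto_const lim])
      show "\<forall>\<^sub>F l in sequentially. 0 \<le> (\<Sum>k\<in>lattice_box (diag ((l + 1)\<^sup>2)). excess (real l powr (1/4)) (Xs k \<omega>))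
            / real l ^ (2 * CARD('d))"
        by (simp add: sum_nonneg excess_nonneg)
      show "\<forall>\<^sub>F l in sequentially. (\<Sum>k\<in>lattice_box (diag ((l + 1)\<^sup>2)). excess (real l powr (1/4)) (Xs k \<omega>))
            / real l ^ (2 * CARD('d)) \<le> V (floor_log l) \<omega>"
        \<comment> \<open>The lower bound \<open>2 ^ floor_log l \<le> l\<close> fails at
          \<open>l = 0\<close>, where \<open>floor_log\<close> is 0.\<close>
        using eventually_ge_at_top[of 1]
      proof eventually_elim
        case (elim l)
        define j where "j = floor_log l"
        have lo: "2 ^ j \<le> l" and hi: "l + 1 \<le> 2 ^ Suc j"
          using elim floor_log_exp2_le[of l] floor_log_exp2_gt[of l] by (auto simp: j_def)
        have "(l + 1)\<^sup>2 \<le> (2 ^ Suc j)\<^sup>2"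
          using hi by (rule power_mono) simp
        also have "\<dots> = 4 ^ Suc j"
          using power_mult[of "2::nat" 2 "Suc j"] power_mult[of "2::nat" "Suc j" 2] by (simp only: mult.commute) simp
        finally have box: "lattice_box (diag ((l + 1)\<^sup>2)) \<subseteq> (lattice_box (diag (4 ^ Suc j)) :: (nat ^ 'd) set)"
          by (rule lattice_box_diag_mono)
        have lo': "2 ^ j \<le> real l"
          using lo by (metis of_nat_le_iff of_nat_numeral of_nat_power)
        have "2 powr (real j / 4) = (2 powr real j) powr (1/4)"
          by (simp add: powr_powr)
        also have "\<dots> \<le> real l powr (1/4)"
          using lo' by (intro powr_mono2) (auto simp: powr_realpow)
        finally have level: "2 powr (real j / 4) \<le> real l powr (1/4)" .
        have "(\<Sum>k\<in>lattice_box (diag ((l + 1)\<^sup>2)). excess (real l powr (1/4)) (Xs k \<omega>))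
            \<le> (\<Sum>k\<in>lattice_box (diag (4 ^ Suc j)). excess (real l powr (1/4)) (Xs k \<omega>))"
          by (intro sum_mono2 box finite_lattice_box excess_nonneg)
        also have "\<dots> \<le> (\<Sum>k\<in>lattice_box (diag (4 ^ Suc j)). excess (2 powr (real j / 4)) (Xs k \<omega>))"
          by (intro sum_mono excess_antimono level)
        finally have num: "(\<Sum>k\<in>lattice_box (diag ((l + 1)\<^sup>2)). excess (real l powr (1/4)) (Xs k \<omega>)) \<le> \<dots>" .
        have "(4::real) ^ (j * CARD('d)) = 2 ^ (2 * (j * CARD('d)))"
          by (simp add: power_mult)
        also have "\<dots> = (2 ^ j) ^ (2 * CARD('d))"
          by (simp only: power_mult[symmetric] mult.left_commute)
        also have "\<dots> \<le> real l ^ (2 * CARD('d))"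
          using lo' by (intro power_mono) auto
        finally have den: "(4::real) ^ (j * CARD('d)) \<le> real l ^ (2 * CARD('d))" .
        show ?case
          unfolding V_def j_def[symmetric]
          using num den by (intro frac_le) (auto intro: sum_nonneg excess_nonneg)
      qed
    qed
  qed
qed

section \<open>Mean-square convergence of the truncated transform\<close>

lemma borel_measurable_freq_dot [measurable]: "freq_dot k \<in> borel_measurable borel"
  unfolding freq_dot_def by measurable

lemma sets_torus [measurable]: "torus \<in> sets borel"
  unfolding torus_def by measurable

text \<open>For each fixed \<omega>, Parseval in \<open>t\<close> bounds the mean square, so the
  orthogonality is that of the exponentials and not of the random variables. Summability then gives
  convergence almost everywhere on the product space, which Fubini splits into \<open>t\<close>
  first and \<omega> second.\<close>

lemma (in prob_space) AE_truncated_dft_tendsto_0: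
  fixes Xs :: "nat ^ 'd \<Rightarrow> 'a \<Rightarrow> real"
  assumes Xs: "\<And>n. n \<in> pos_lattice \<Longrightarrow> Xs n \<in> borel_measurable M"
  shows "AE t in lborel. t \<in> torus \<longrightarrow> (AE \<omega> in M.
           (\<lambda>l. dft (\<lambda>k \<omega>. truncate (real l powr (1/4)) (Xs k \<omega>)) (diag (l\<^sup>2)) t \<omega>
              / of_real (real l ^ (2 * CARD('d)))) \<longlonglongrightarrow> 0)"
proof -
  interpret pair_sigma_finite "lborel :: (real ^ 'd) measure" M ..
  define T where "T l t \<omega> = (\<Sum>k\<in>lattice_box (diag (l\<^sup>2)).
      cis (freq_dot k t) * of_real (truncate (real l powr (1/4)) (Xs k \<omega>)))" for l and t :: "real ^ 'd" and \<omega>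
  define L where "L l = real l ^ (2 * CARD('d))" for l
  define f where "f l = (\<lambda>(t, \<omega>). indicator torus t * (cmod (T l t \<omega>))\<^sup>2 / (L l)\<^sup>2)" for l
  have m: "Xs k \<in> borel_measurable M" if "k \<in> lattice_box n" for k n
    using that Xs by (auto simp: lattice_box_def)
  have T_m: "(\<lambda>(t, \<omega>). T l t \<omega>) \<in> borel_measurable (lborel \<Otimes>\<^sub>M M)" for l
    unfolding T_def case_prod_unfold
  proof (rule borel_measurable_sum)
    fix k :: "nat ^ 'd"
    assume "k \<in> lattice_box (diag (l\<^sup>2))"
    from m[OF this] have [measurable]: "Xs k \<in> borel_measurable M" .
    show "(\<lambda>x. cis (freq_dot k (fst x)) * of_real (truncate (real l powr (1/4)) (Xs k (snd x))))
        \<in> borel_measurable (lborel \<Otimes>\<^sub>M M)"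
      by measurable
  qed
  have f_m [measurable]: "f l \<in> borel_measurable (lborel \<Otimes>\<^sub>M M)" for l
    using T_m[of l] unfolding f_def case_prod_unfold by measurable
  have f_le: "(\<integral>\<^sup>+z. ennreal (f l z) \<partial>(lborel \<Otimes>\<^sub>M M)) \<le> ennreal ((2 * pi) ^ CARD('d) * real l powr (- 3 / 2))" for l
  proof (cases "l = 0")
    \<comment> \<open>Both sides are 0 here: \<open>L 0 = 0\<close> and division by 0 yields 0,
      while \<open>powr\<close> with base 0 is 0.\<close>
    case True
    then show ?thesis by (simp add: f_def L_def case_prod_unfold power_0_left)
  next
    case False
    then have L_pos: "0 < L l" by (simp add: L_def)
    have "(\<integral>\<^sup>+t. ennreal (f l (t, \<omega>)) \<partial>lborel) \<le> ennreal ((2 * pi) ^ CARD('d) * real l powr (- 3 / 2))" for \<omega>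
    proof -
      let ?c = "\<lambda>k. truncate (real l powr (1/4)) (Xs k \<omega>)"
      have [measurable]: "(\<lambda>t. T l t \<omega>) \<in> borel_measurable borel"
        unfolding T_def by measurable
      have "(\<integral>\<^sup>+t. ennreal (f l (t, \<omega>)) \<partial>lborel)
          = (\<integral>\<^sup>+t. ennreal (1 / (L l)\<^sup>2) * (ennreal ((cmod (T l t \<omega>))\<^sup>2) * indicator torus t) \<partial>lborel)"
        by (intro nn_integral_cong) (auto simp: f_def indicator_def simp flip: ennreal_mult')
      also have "\<dots> = ennreal (1 / (L l)\<^sup>2) * (\<integral>\<^sup>+t\<in>torus. ennreal ((cmod (T l t \<omega>))\<^sup>2) \<partial>lborel)"
        by (rule nn_integral_cmult) measurable
      also have "\<dots> = ennreal ((2 * pi) ^ CARD('d) * ((\<Sum>k\<in>lattice_box (diag (l\<^sup>2)). (?c k)\<^sup>2) / (L l)\<^sup>2))"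
        unfolding T_def by (simp add: Parseval_torus finite_lattice_box flip: ennreal_mult')
      also have "\<dots> \<le> ennreal ((2 * pi) ^ CARD('d) * real l powr (- 3 / 2))"
      proof (intro ennreal_leI mult_left_mono)
        have "(\<Sum>k\<in>lattice_box (diag (l\<^sup>2)). (?c k)\<^sup>2)
            \<le> (\<Sum>k\<in>(lattice_box (diag (l\<^sup>2)) :: (nat ^ 'd) set). (real l powr (1/4))\<^sup>2)"
          by (intro sum_mono) (metis abs_truncate_le powr_ge_zero power_mono abs_ge_zero power2_abs)
        also have "\<dots> = L l * real l powr (1/2)"
          by (simp add: card_lattice_box lattice_vol_diag L_def power_mult powr_powr flip: powr_add power2_eq_square)
            (simp add: power2_eq_square flip: powr_add)
        finally have "(\<Sum>k\<in>lattice_box (diag (l\<^sup>2)). (?c k)\<^sup>2) / (L l)\<^sup>2 \<le> real l powr (1/2) / L l"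
          using L_pos by (simp add: field_simps power2_eq_square)
        \<comment> \<open>The dimension is at least 1, so \<open>L l\<close> is at least
          \<open>l\<^sup>2\<close>. This gives the summable exponent 1/2 - 2 = -3/2 in every
          dimension.\<close>
        also have "\<dots> \<le> real l powr (1/2) / (real l)\<^sup>2"
          unfolding L_def using False by (intro divide_left_mono power_increasing) auto
        also have "\<dots> = real l powr (1/2 - 2)"
          using False powr_diff[of "real l" "1/2" 2] by (simp add: powr_numeral)
        finally show "(\<Sum>k\<in>lattice_box (diag (l\<^sup>2)). (?c k)\<^sup>2) / (L l)\<^sup>2 \<le> real l powr (- 3 / 2)"
          by simp
      qed simp
      finally show ?thesis .
    qed
    then have "(\<integral>\<^sup>+\<omega>. (\<integral>\<^sup>+t. ennreal (f l (t, \<omega>)) \<partial>lborel) \<partial>M)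
        \<le> (\<integral>\<^sup>+\<omega>. ennreal ((2 * pi) ^ CARD('d) * real l powr (- 3 / 2)) \<partial>M)"
      by (intro nn_integral_mono) auto
    also have "\<dots> = ennreal ((2 * pi) ^ CARD('d) * real l powr (- 3 / 2))"
      by (simp add: emeasure_space_1)
    finally show ?thesis
      by (subst nn_integral_snd[symmetric]) auto
  qed
  have "AE z in lborel \<Otimes>\<^sub>M M. (\<lambda>l. f l z) \<longlonglongrightarrow> 0"
  proof (rule AE_tendsto_0_of_summable_nn_integral)
    show "0 \<le> f l z" for l z
      by (simp add: f_def case_prod_unfold)
    have "summable (\<lambda>l. (2 * pi) ^ CARD('d) * real l powr (- 3 / 2))"
      by (intro summable_mult) (simp add: summable_real_powr_iff)
    then have "(\<Sum>l. ennreal ((2 * pi) ^ CARD('d) * real l powr (- 3 / 2))) < \<infinity>"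
      by (simp add: ennreal_suminf_neq_top less_top)
    moreover have "(\<Sum>l. \<integral>\<^sup>+z. ennreal (f l z) \<partial>(lborel \<Otimes>\<^sub>M M)) \<le> (\<Sum>l. ennreal ((2 * pi) ^ CARD('d) * real l powr (- 3 / 2)))"
      by (intro suminf_le f_le) auto
    ultimately show "(\<Sum>l. \<integral>\<^sup>+z. ennreal (f l z) \<partial>(lborel \<Otimes>\<^sub>M M)) < \<infinity>"
      by (rule le_less_trans[rotated])
  qed measurable
  then have "AE t in lborel. AE \<omega> in M. (\<lambda>l. f l (t, \<omega>)) \<longlonglongrightarrow> 0"
    by (rule AE_pair)
  then show ?thesis
  proof (eventually_elim, intro impI)
    fix t :: "real ^ 'd"
    assume "AE \<omega> in M. (\<lambda>l. f l (t, \<omega>)) \<longlonglongrightarrow> 0" and "t \<in> torus"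
    from this(1) show "AE \<omega> in M.
           (\<lambda>l. dft (\<lambda>k \<omega>. truncate (real l powr (1/4)) (Xs k \<omega>)) (diag (l\<^sup>2)) t \<omega>
              / of_real (real l ^ (2 * CARD('d)))) \<longlonglongrightarrow> 0"
    proof eventually_elim
      case (elim \<omega>)
      \<comment> \<open>The square root undoes the square in \<open>f\<close>; for \<open>t\<close>
        in the torus the indicator is 1.\<close>
      then have "(\<lambda>l. sqrt (f l (t, \<omega>))) \<longlonglongrightarrow> sqrt 0"
        by (rule tendsto_real_sqrt)
      moreover have "sqrt (f l (t, \<omega>)) = norm (T l t \<omega> / of_real (L l))" for l
        using \<open>t \<in> torus\<close> by (simp add: f_def real_sqrt_divide norm_divide)
      ultimately have "(\<lambda>l. T l t \<omega> / of_real (L l)) \<longlonglongrightarrow> 0"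
        by (simp add: tendsto_norm_zero_iff)
      then show "(\<lambda>l. dft (\<lambda>k \<omega>. truncate (real l powr (1/4)) (Xs k \<omega>)) (diag (l\<^sup>2)) t \<omega>
              / of_real (real l ^ (2 * CARD('d)))) \<longlonglongrightarrow> 0"
        by (simp add: T_def L_def dft_def cis_conv_exp)
    qed
  qed
qed

section \<open>Interpolation between square side lengths and the limit along the diagonal\<close>

lemma norm_dft_diff_truncated_le:
  fixes X :: "nat ^ 'd \<Rightarrow> 'a \<Rightarrow> real"
  assumes "p \<le> n" "n \<le> q" "0 \<le> a"
  shows "norm (dft X (diag n) t \<omega> - dft (\<lambda>k \<omega>. truncate a (X k \<omega>)) (diag p) t \<omega>)
       \<le> (\<Sum>k\<in>lattice_box (diag q). excess a (X k \<omega>)) + a * (real q ^ CARD('d) - real p ^ CARD('d))"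
proof -
  let ?B = "\<lambda>n. lattice_box (diag n) :: (nat ^ 'd) set"
  let ?e = "\<lambda>k. exp (\<i> * complex_of_real (freq_dot k t))"
  let ?T = "\<lambda>k. truncate a (X k \<omega>)"
  have sub: "?B p \<subseteq> ?B n" "?B n \<subseteq> ?B q"
    using assms by (auto dest: lattice_box_diag_mono)
  have e: "norm (?e k) = 1" for k
    by simp
  \<comment> \<open>Two errors are separated: truncating inside the box of side \<open>n\<close>,
    which costs the excesses, and shrinking the truncated sum to side \<open>p\<close>, which costs
    at most \<open>a\<close> per lattice point lost. Both are then enlarged to side
    \<open>q\<close>, so that the bound is uniform for \<open>n\<close> between \<open>p\<close> and
    \<open>q\<close>.\<close>
  have "dft X (diag n) t \<omega> = (\<Sum>k\<in>?B n. ?e k * of_real (X k \<omega> - ?T k)) + (\<Sum>k\<in>?B n. ?e k * of_real (?T k))"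
    by (simp add: dft_def algebra_simps flip: sum.distrib)
  also have "(\<Sum>k\<in>?B n. ?e k * of_real (?T k)) = (\<Sum>k\<in>?B n - ?B p. ?e k * of_real (?T k)) + (\<Sum>k\<in>?B p. ?e k * of_real (?T k))"
    by (rule sum.subset_diff[OF sub(1) finite_lattice_box])
  finally have "norm (dft X (diag n) t \<omega> - dft (\<lambda>k \<omega>. truncate a (X k \<omega>)) (diag p) t \<omega>)
      = norm ((\<Sum>k\<in>?B n. ?e k * of_real (X k \<omega> - ?T k)) + (\<Sum>k\<in>?B n - ?B p. ?e k * of_real (?T k)))"
    by (simp add: dft_def)
  also have "\<dots> \<le> (\<Sum>k\<in>?B n. \<bar>X k \<omega> - ?T k\<bar>) + (\<Sum>k\<in>?B n - ?B p. \<bar>?T k\<bar>)"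
    by (intro norm_triangle_mono sum_norm_le) (simp_all add: norm_mult del: of_real_diff)
  also have "(\<Sum>k\<in>?B n. \<bar>X k \<omega> - ?T k\<bar>) = (\<Sum>k\<in>?B n. excess a (X k \<omega>))"
    by (intro sum.cong) (auto simp: truncate_def excess_def)
  also have "\<dots> \<le> (\<Sum>k\<in>?B q. excess a (X k \<omega>))"
    by (intro sum_mono2 sub finite_lattice_box excess_nonneg)
  also have "(\<Sum>k\<in>?B n - ?B p. \<bar>?T k\<bar>) \<le> (\<Sum>k\<in>?B q - ?B p. a)"
    using assms sub by (intro order_trans[OF sum_mono[OF abs_truncate_le] sum_mono2]) (auto simp: finite_lattice_box)
  also have "\<dots> = a * (real q ^ CARD('d) - real p ^ CARD('d))"
  proof -
    have "card (?B q - ?B p) = q ^ CARD('d) - p ^ CARD('d)"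
      using sub by (subst card_Diff_subset) (auto simp: finite_lattice_box card_lattice_box lattice_vol_diag)
    moreover have "p ^ CARD('d) \<le> q ^ CARD('d)"
      using assms by (intro power_mono) auto
    ultimately show ?thesis
      by (simp add: of_nat_diff)
  qed
  finally show ?thesis
    by simp
qed

theorem mainTheorem7:
  fixes P :: "'a measure"
    and X :: "'a \<Rightarrow> real"
    and Xs :: "nat ^ 'd \<Rightarrow> 'a \<Rightarrow> real"
    and M :: real
  assumes "prob_space P"
    and "X \<in> borel_measurable P"
    and "\<And>n. n \<in> pos_lattice \<Longrightarrow> Xs n \<in> borel_measurable P"
    and "M > 0"
    and "\<And>x n. 0 \<le> x \<Longrightarrow> n \<in> pos_lattice \<Longrightarrow>
           1 / real (lattice_vol n) * (\<Sum>k\<in>lattice_box n. \<P>(\<omega> in P. \<bar>Xs k \<omega>\<bar> > x))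
             \<le> M * \<P>(\<omega> in P. \<bar>X \<omega>\<bar> > x)"
    and "integrable P (\<lambda>\<omega>. \<bar>X \<omega>\<bar> * log_plus \<bar>X \<omega>\<bar>)"
  shows "AE t\<in>torus in lebesgue. AE \<omega> in P.
           (\<lambda>n. dft Xs (diag n) t \<omega> / of_nat (lattice_vol (diag n :: nat ^ 'd))) \<longlonglongrightarrow> 0"
proof -
  interpret prob_space P by fact
  define L where "L l = real l ^ (2 * CARD('d))" for l
  define T where "T l t \<omega> = dft (\<lambda>k \<omega>. truncate (real l powr (1/4)) (Xs k \<omega>)) (diag (l\<^sup>2)) t \<omega>" for l t \<omega>
  define W where "W l \<omega> = (\<Sum>k\<in>lattice_box (diag ((l + 1)\<^sup>2)). excess (real l powr (1/4)) (Xs k \<omega>))" for l \<omega>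
  define g where "g l = real l powr (1/4) * ((real l + 1) ^ (2 * CARD('d)) - real l ^ (2 * CARD('d))) / L l" for l
  have "(\<Sum>k\<in>lattice_box n. \<P>(\<omega> in P. x < \<bar>Xs k \<omega>\<bar>))
      \<le> M * real (lattice_vol n) * \<P>(\<omega> in P. x < \<bar>X \<omega>\<bar>)" if "0 \<le> x" "n \<in> pos_lattice" for x n
  proof -
    have "0 < lattice_vol n"
      using that by (auto simp: lattice_vol_def pos_lattice_def intro!: prod_pos Suc_le_lessD)
    then show ?thesis
      using assms(5)[OF that] by (simp add: field_simps)
  qed
  \<comment> \<open>The exceptional null set obtained here does not depend on
    \<open>t\<close>.\<close>
  then have W: "AE \<omega> in P. (\<lambda>l. W l \<omega> / L l) \<longlonglongrightarrow> 0"
    unfolding W_def L_def using assms by (intro AE_excess_average_tendsto_0[where C = M and X = X]) auto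
  \<comment> \<open>The difference of powers is of order \<open>l\<close> to the
    \<open>2 * CARD('d) - 1\<close>, so \<open>g l\<close> is of order \<open>l\<close> to the
    -3/4.\<close>
  have g: "g \<longlonglongrightarrow> 0"
    unfolding g_def L_def by real_asymp
  have floor_sqrt_lim: "filterlim floor_sqrt at_top sequentially"
    by (rule filterlim_at_top_at_top[where P = "\<lambda>_. True" and Q = "\<lambda>_. True" and g = "\<lambda>n. n\<^sup>2"])
      (auto intro: monoD[OF mono_floor_sqrt])
  \<comment> \<open>A deterministic statement for fixed \<open>t\<close> and \<omega>: the choice
    \<open>l = floor_sqrt n\<close> puts \<open>n\<close> between \<open>l\<^sup>2\<close> and
    \<open>(l + 1)\<^sup>2\<close>, and the limit follows by comparison with
    \<open>h\<close>.\<close>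
  have lim: "(\<lambda>n. dft Xs (diag n) t \<omega> / of_nat (lattice_vol (diag n :: nat ^ 'd))) \<longlonglongrightarrow> 0"
    if "(\<lambda>l. T l t \<omega> / of_real (L l)) \<longlonglongrightarrow> 0" "(\<lambda>l. W l \<omega> / L l) \<longlonglongrightarrow> 0" for t \<omega>
  proof -
    define h where "h l = norm (T l t \<omega> / of_real (L l)) + W l \<omega> / L l + g l" for l
    have "h \<longlonglongrightarrow> 0"
      unfolding h_def using tendsto_add[OF tendsto_add[OF tendsto_norm_zero[OF that(1)] that(2)] g] by simp
    then have "(\<lambda>n. h (floor_sqrt n)) \<longlonglongrightarrow> 0"
      using floor_sqrt_lim by (rule filterlim_compose)
    moreover have "\<forall>\<^sub>F n in sequentially. norm (dft Xs (diag n) t \<omega> / of_nat (lattice_vol (diag n :: nat ^ 'd))) \<le> h (floor_sqrt n)"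
      using eventually_ge_at_top[of 1]
    proof eventually_elim
      case (elim n)
      define l where "l = floor_sqrt n"
      have l: "0 < l" "l\<^sup>2 \<le> n" "n \<le> (l + 1)\<^sup>2"
        using elim Suc_floor_sqrt_power2_gt[of n] by (auto simp: l_def)
      then have L_pos: "0 < L l"
        by (simp add: L_def)
      let ?R = "norm (T l t \<omega>) + (W l \<omega> + real l powr (1/4) * ((real l + 1) ^ (2 * CARD('d)) - real l ^ (2 * CARD('d))))"
      have "norm (dft Xs (diag n) t \<omega> - T l t \<omega>)
          \<le> W l \<omega> + real l powr (1/4) * ((real l + 1) ^ (2 * CARD('d)) - real l ^ (2 * CARD('d)))"
        using norm_dft_diff_truncated_le[OF l(2,3), of "real l powr (1/4)" Xs t \<omega>]
        by (simp add: T_def W_def power_mult add.commute)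
      then have "norm (dft Xs (diag n) t \<omega>) \<le> ?R"
        using norm_triangle_ineq2[of "dft Xs (diag n) t \<omega>" "T l t \<omega>"] by linarith
      \<comment> \<open>Replacing the volume of the box of side \<open>n\<close> by the smaller
        \<open>L l\<close> only increases the quotient, and it makes all three error terms share the
        denominator of \<open>h\<close>.\<close>
      moreover have "L l \<le> real n ^ CARD('d)"
      proof -
        have "L l = (real (l\<^sup>2)) ^ CARD('d)"
          by (simp add: L_def power_mult)
        also have "\<dots> \<le> real n ^ CARD('d)"
          using l(2) by (intro power_mono of_nat_mono) auto
        finally show ?thesis .
      qed
      ultimately have "norm (dft Xs (diag n) t \<omega>) / real n ^ CARD('d) \<le> ?R / L l"
        using L_pos order_trans[OF norm_ge_zero] by (intro frac_le) blast+
      also have "\<dots> = h l"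
        using L_pos by (simp add: h_def g_def norm_divide add_divide_distrib)
      finally show ?case
        by (simp add: lattice_vol_diag norm_divide norm_power l_def)
    qed
    ultimately show ?thesis
      by (rule Lim_null_comparison[rotated])
  qed
  have "AE t in lborel. t \<in> torus \<longrightarrow> (AE \<omega> in P. (\<lambda>l. T l t \<omega> / of_real (L l)) \<longlonglongrightarrow> 0)"
    unfolding T_def L_def by (rule AE_truncated_dft_tendsto_0[OF assms(3)])
  then have "AE t in lborel. t \<in> torus \<longrightarrow> (AE \<omega> in P.
      (\<lambda>n. dft Xs (diag n) t \<omega> / of_nat (lattice_vol (diag n :: nat ^ 'd))) \<longlonglongrightarrow> 0)"
  proof (eventually_elim, intro impI)
    fix t :: "real ^ 'd"
    assume "t \<in> torus" and "t \<in> torus \<longrightarrow> (AE \<omega> in P. (\<lambda>l. T l t \<omega> / of_real (L l)) \<longlonglongrightarrow> 0)"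
    then have "AE \<omega> in P. (\<lambda>l. T l t \<omega> / of_real (L l)) \<longlonglongrightarrow> 0"
      by blast
    with W show "AE \<omega> in P. (\<lambda>n. dft Xs (diag n) t \<omega> / of_nat (lattice_vol (diag n :: nat ^ 'd))) \<longlonglongrightarrow> 0"
      by eventually_elim (rule lim)
  qed
  then show ?thesis
    \<comment> \<open>The Fubini argument ran over \<open>lborel\<close>; \<open>lebesgue\<close> is
      its completion, and null sets remain null there.\<close>
    by (rule AE_completion)
qed

end
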